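(* Let $G=(V,E)$ be a weakly bridged graph. The following conditions are equivalent: (1) $G$ is strongly smooth; (2) $G$ is smooth; (3) $G$ contains neither $K_{2,3}^+$ nor $R_1$ as an isometric subgraph.
   Context: All graphs are undirected, connected, without loops or multiple edges, and not necessarily finite. $d=d_G$ is the shortest-path distance. The interval is $I(u,v):=\{x\in V: d(u,x)+d(x,v)=d(u,v)\}$. A set $A\subseteq V$ is convex if $I(x,y)\subseteq A$ for all $x,y\in A$; $\mathrm{conv}(S)$ is the smallest convex set containing $S$. The distance point-shadow of $v$ with respect to $u$ is $v|u:=\{x\in V: v\in I(u,x)\}$, and the point-shadow is $v/u:=\{x\in V: v\in \mathrm{conv}(\{u,x\})\}$. $G$ is smooth if $v|u$ is convex for all $u,v\in V$, and strongly smooth if $v/u$ is convex for all $u,v\in V$. $G$ is weakly modular if it satisfies: (TC) for any $u,v,s\in V$ with $d(u,v)=1$ and $d(u,s)=d(v,s)$, there is a common neighbor $x$ of $u$ and $v$ with $d(s,x)=d(s,u)-1$; (QC) for any $u,v,w,s\in V$ with $d(u,w)=d(v,w)=1$, $d(u,v)=2$ and $d(s,u)=d(s,v)=d(s,w)-1$, there is a common neighbor $x$ of $u$ and $v$ with $d(s,x)=d(s,u)-1$. $G$ is weakly bridged if it is weakly modular and all its balls $B_r(s)=\{x\in V: d(s,x)\le r\}$ are convex; equivalently (a known result), if it is weakly modular and has no induced 4-cycle. $G$ contains a graph $H$ as an isometric subgraph if there is a map $f:V(H)\to V$ with $d_G(f(x),f(y))=d_H(x,y)$ for all $x,y\in V(H)$.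 The graphs are: - $K_{2,3}^+$ (the propeller): the complete bipartite graph $K_{2,3}$ plus an edge joining its two vertices of degree 3. - $R_1$: vertices $u,v,x,a,b,w,y$; edges $uv, vx, xa, ay, yw, wb, bu, vb, ba, aw, wx, xb, va$. *)

theory Defs
  imports Main "HOL.Hull"
begin

text \<open>A graph is given by its vertex set \<open>V\<close> and its set \<open>E\<close> of edges, which are
  two-element subsets of \<open>V\<close>; so there are no loops and no multiple edges.  \<open>V\<close> may be infinite.\<close>

definition adjacency :: "'a set set \<Rightarrow> ('a \<times> 'a) set" where
  "adjacency E = {(x, y). {x, y} \<in> E}"

locale connected_graph =
  fixes V :: "'a set" and E :: "'a set set"
  assumes edges: "e \<in> E \<Longrightarrow> e \<subseteq> V \<and> card e = 2"
    and connected: "u \<in> V \<Longrightarrow> v \<in> V \<Longrightarrow> (u, v) \<in> (adjacency E)\<^sup>*"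

text \<open>The pair \<open>(u, v)\<close> is in the \<open>n\<close>-th relational power of the adjacency relation iff there is
  a walk of length \<open>n\<close> from \<open>u\<close> to \<open>v\<close>.  The value is meaningful only if there is some walk, which
  for vertices of a connected graph is always the case.\<close>

definition gdist :: "'a set set \<Rightarrow> 'a \<Rightarrow> 'a \<Rightarrow> nat" where
  "gdist E u v = (LEAST n. (u, v) \<in> adjacency E ^^ n)"

definition interval :: "'a set \<Rightarrow> 'a set set \<Rightarrow> 'a \<Rightarrow> 'a \<Rightarrow> 'a set" where
  "interval V E u v = {x \<in> V. gdist E u x + gdist E x v = gdist E u v}"

definition gconvex :: "'a set \<Rightarrow> 'a set set \<Rightarrow> 'a set \<Rightarrow> bool" where
  "gconvex V E A \<longleftrightarrow> A \<subseteq> V \<and> (\<forall>x\<in>A. \<forall>y\<in>A. interval V E x y \<subseteq> A)"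

definition gconv :: "'a set \<Rightarrow> 'a set set \<Rightarrow> 'a set \<Rightarrow> 'a set" where
  "gconv V E S = gconvex V E hull S"

definition distance_point_shadow :: "'a set \<Rightarrow> 'a set set \<Rightarrow> 'a \<Rightarrow> 'a \<Rightarrow> 'a set" where
  "distance_point_shadow V E v u = {x \<in> V. v \<in> interval V E u x}"

definition point_shadow :: "'a set \<Rightarrow> 'a set set \<Rightarrow> 'a \<Rightarrow> 'a \<Rightarrow> 'a set" where
  "point_shadow V E v u = {x \<in> V. v \<in> gconv V E {u, x}}"

definition smooth :: "'a set \<Rightarrow> 'a set set \<Rightarrow> bool" where
  "smooth V E \<longleftrightarrow> (\<forall>u\<in>V. \<forall>v\<in>V. gconvex V E (distance_point_shadow V E v u))"

definition strongly_smooth :: "'a set \<Rightarrow> 'a set set \<Rightarrow> bool" where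
  "strongly_smooth V E \<longleftrightarrow> (\<forall>u\<in>V. \<forall>v\<in>V. gconvex V E (point_shadow V E v u))"

text \<open>The equations \<open>d(s,x) = d(s,u) - 1\<close> are written with \<open>Suc\<close>, to avoid truncated
  subtraction.\<close>

definition triangle_condition :: "'a set \<Rightarrow> 'a set set \<Rightarrow> bool" where
  "triangle_condition V E \<longleftrightarrow>
    (\<forall>u\<in>V. \<forall>v\<in>V. \<forall>s\<in>V. gdist E u v = 1 \<and> gdist E u s = gdist E v s \<longrightarrow>
      (\<exists>x\<in>V. {x, u} \<in> E \<and> {x, v} \<in> E \<and> Suc (gdist E s x) = gdist E s u))"

definition quadrangle_condition :: "'a set \<Rightarrow> 'a set set \<Rightarrow> bool" where
  "quadrangle_condition V E \<longleftrightarrow>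
    (\<forall>u\<in>V. \<forall>v\<in>V. \<forall>w\<in>V. \<forall>s\<in>V.
      gdist E u w = 1 \<and> gdist E v w = 1 \<and> gdist E u v = 2 \<and>
      gdist E s u = gdist E s v \<and> Suc (gdist E s u) = gdist E s w \<longrightarrow>
      (\<exists>x\<in>V. {x, u} \<in> E \<and> {x, v} \<in> E \<and> Suc (gdist E s x) = gdist E s u))"

definition weakly_modular :: "'a set \<Rightarrow> 'a set set \<Rightarrow> bool" where
  "weakly_modular V E \<longleftrightarrow> triangle_condition V E \<and> quadrangle_condition V E"

definition gball :: "'a set \<Rightarrow> 'a set set \<Rightarrow> 'a \<Rightarrow> nat \<Rightarrow> 'a set" where
  "gball V E s r = {x \<in> V. gdist E s x \<le> r}"

definition weakly_bridged :: "'a set \<Rightarrow> 'a set set \<Rightarrow> bool" where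
  "weakly_bridged V E \<longleftrightarrow>
    weakly_modular V E \<and> (\<forall>s\<in>V. \<forall>r. gconvex V E (gball V E s r))"

definition contains_isometric ::
  "'a set \<Rightarrow> 'a set set \<Rightarrow> 'b set \<Rightarrow> 'b set set \<Rightarrow> bool" where
  "contains_isometric V E VH EH \<longleftrightarrow>
    (\<exists>f. f ` VH \<subseteq> V \<and> (\<forall>x\<in>VH. \<forall>y\<in>VH. gdist E (f x) (f y) = gdist EH x y))"

text \<open>The propeller is \<open>K\<^bsub>2,3\<^esub>\<close> with sides \<open>{0, 1}\<close> and \<open>{2, 3, 4}\<close>, together with the edge
  joining the two vertices of degree 3.\<close>

definition propeller_verts :: "nat set" where
  "propeller_verts = {0, 1, 2, 3, 4}"

definition propeller_edges :: "nat set set" where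
  "propeller_edges = {{i, j} | i j. i \<in> {0, 1} \<and> j \<in> {2, 3, 4}} \<union> {{0, 1}}"

datatype R1_vertex = Ru | Rv | Rx | Ra | Rb | Rw | Ry

definition R1_edges :: "R1_vertex set set" where
  "R1_edges =
    {{Ru, Rv}, {Rv, Rx}, {Rx, Ra}, {Ra, Ry}, {Ry, Rw}, {Rw, Rb}, {Rb, Ru},
     {Rv, Rb}, {Rb, Ra}, {Ra, Rw}, {Rw, Rx}, {Rx, Rb}, {Rv, Ra}}"

end

theory Submission
  imports Defs
begin

text \<open>Two consequences of the hypothesis drive the proof: the triangle condition, and the fact
  that the neighbours of a vertex \<open>w\<close> that are closer to a vertex \<open>s\<close> than \<open>w\<close> form a clique
  (\<open>closer_nbrs_adj\<close>).  If two of them were nonadjacent, then \<open>w\<close> would lie between them and so, by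
  convexity, in a ball around \<open>s\<close> that contains them but not \<open>w\<close>.

  These two properties also reduce convexity to a local question: a set that induces a connected
  subgraph is convex as soon as it contains the common neighbours of its nonadjacent vertices
  (\<open>locally_convex_imp_convex\<close>).  For two families of sets the local question is answered by building
  a forbidden subgraph out of a counterexample, with all further vertices supplied by the triangle
  condition.

  A failure in an interval \<open>I(u, v)\<close> happens between two consecutive levels and produces \<open>R\<^sub>1\<close>.  So
  without \<open>R\<^sub>1\<close> all intervals are convex (\<open>interval_convex\<close>), and \<open>conv {u, v}\<close> is
  \<open>I(u, v)\<close>; the two kinds of shadows coincide, and with them smoothness and strong smoothness.
  A failure in a distance shadow produces a propeller or \<open>R\<^sub>1\<close>
  (\<open>distance_point_shadow_convex\<close>).

  Conversely, each forbidden subgraph refutes convexity of a shadow: it has vertices \<open>x, y\<close> in the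
  shadow of \<open>v\<close> with respect to some \<open>u\<close>, and a vertex \<open>w\<close> between \<open>x\<close> and \<open>y\<close> with
  \<open>d(u, w) \<le> 2\<close> that is not in this shadow.  Intervals of length at most two are convex in every
  weakly bridged graph, so for the pair \<open>u, w\<close> hull and interval agree, and a single argument treats
  both kinds of shadows (\<open>no_forbidden_subgraph\<close>).\<close>

section \<open>Distances in a connected graph\<close>

lemma walk_mono: "(u, v) \<in> R ^^ n \<Longrightarrow> R \<subseteq> S \<Longrightarrow> (u, v) \<in> S ^^ n"
  for R S :: "('a \<times> 'a) set"
proof (induction n arbitrary: v)
  case (Suc n)
  then obtain w where "(u, w) \<in> R ^^ n" "(w, v) \<in> R" by auto
  with Suc show ?case by (meson relpow_Suc_I subsetD)
qed simp

lemma gdist_le_walk: "(u, v) \<in> adjacency E ^^ n \<Longrightarrow> gdist E u v \<le> n"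
  unfolding gdist_def by (rule Least_le)

lemma sym_walk: "(u, v) \<in> adjacency E ^^ n \<Longrightarrow> (v, u) \<in> adjacency E ^^ n"
proof (induction n arbitrary: v)
  case (Suc n)
  then obtain w where w: "(u, w) \<in> adjacency E ^^ n" "(w, v) \<in> adjacency E" by auto
  then have "(v, w) \<in> adjacency E" by (simp add: adjacency_def insert_commute)
  with Suc.IH[OF w(1)] show ?case by (meson relpow_Suc_I2)
qed simp

lemma gdist_commute: "gdist E u v = gdist E v u"
  unfolding gdist_def by (metis sym_walk)

text \<open>A certificate for the distances from a single vertex \<open>x\<close>: a function that changes by at most one
  along edges bounds the length of walks from below, and following predecessors gives walks that
  attain the bound.\<close>

lemma gdist_eqI:
  assumes "D x = 0"
    and lip: "\<And>y z. {y, z} \<in> E \<Longrightarrow> D z \<le> Suc (D y)"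
    and zero: "\<And>y. y \<in> S \<Longrightarrow> D y = 0 \<Longrightarrow> y = x"
    and pred: "\<And>y n. y \<in> S \<Longrightarrow> D y = Suc n \<Longrightarrow> \<exists>z\<in>S. {z, y} \<in> E \<and> D z = n"
    and "y \<in> S"
  shows "gdist E x y = D y"
proof -
  have walk: "(x, y) \<in> adjacency E ^^ n" if "y \<in> S" "D y = n" for y n
    using that
  proof (induction n arbitrary: y)
    case 0
    with zero show ?case by auto
  next
    case (Suc n)
    then obtain z where "z \<in> S" "{z, y} \<in> E" "D z = n" using pred by blast
    then show ?case using Suc.IH[of z] by (auto simp: adjacency_def)
  qed
  have lower: "D y \<le> n" if "(x, y) \<in> adjacency E ^^ n" for y n
    using that
  proof (induction n arbitrary: y)
    case 0
    with \<open>D x = 0\<close> show ?case by simp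
  next
    case (Suc n)
    then obtain z where "(x, z) \<in> adjacency E ^^ n" "{z, y} \<in> E" by (auto simp: adjacency_def)
    with Suc.IH[of z] lip[of z y] show ?case by linarith
  qed
  show ?thesis
    unfolding gdist_def using walk[OF \<open>y \<in> S\<close>] lower by (intro Least_equality) auto
qed

context connected_graph
begin

abbreviation dist :: "'a \<Rightarrow> 'a \<Rightarrow> nat" where
  "dist \<equiv> gdist E"

definition adj :: "'a \<Rightarrow> 'a \<Rightarrow> bool" where
  "adj x y \<longleftrightarrow> {x, y} \<in> E"

lemma adj_commute: "adj x y \<longleftrightarrow> adj y x"
  by (simp add: adj_def insert_commute)

lemma adjD: "adj x y \<Longrightarrow> x \<in> V \<and> y \<in> V \<and> x \<noteq> y"
  using edges[of "{x, y}"] by (auto simp: adj_def)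

lemma adj_irrefl [simp]: "\<not> adj x x"
  using adjD by blast

lemma walk_dist: "u \<in> V \<Longrightarrow> v \<in> V \<Longrightarrow> (u, v) \<in> adjacency E ^^ dist u v"
  unfolding gdist_def by (rule LeastI_ex) (use connected rtrancl_power in blast)

lemma dist_self [simp]: "dist u u = 0"
  using gdist_le_walk[of u u 0 E] by simp

lemma dist_eq_0 [simp]: "u \<in> V \<Longrightarrow> v \<in> V \<Longrightarrow> dist u v = 0 \<longleftrightarrow> u = v"
  using walk_dist[of u v] by auto

lemma dist_triangle:
  "u \<in> V \<Longrightarrow> v \<in> V \<Longrightarrow> w \<in> V \<Longrightarrow> dist u w \<le> dist u v + dist v w"
  by (rule gdist_le_walk) (use walk_dist[of u v] walk_dist[of v w] in \<open>auto simp: relpow_add\<close>)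

lemma dist_eq_1: "u \<in> V \<Longrightarrow> v \<in> V \<Longrightarrow> dist u v = 1 \<longleftrightarrow> adj u v"
proof
  assume "u \<in> V" "v \<in> V" "dist u v = 1"
  with walk_dist[of u v] show "adj u v" by (simp add: adjacency_def adj_def)
next
  assume uv: "u \<in> V" "v \<in> V" "adj u v"
  then have "dist u v \<le> 1" by (intro gdist_le_walk) (simp add: adjacency_def adj_def)
  with uv adjD[of u v] dist_eq_0[of u v] show "dist u v = 1" by linarith
qed

lemma adj_dist: "adj u v \<Longrightarrow> dist u v = 1"
  using dist_eq_1 adjD by blast

lemma dist_adj_le: "adj x y \<Longrightarrow> s \<in> V \<Longrightarrow> dist s x \<le> Suc (dist s y)"
  using dist_triangle[of s y x] adjD[of x y] adj_dist[of x y] by (simp add: gdist_commute)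

lemma dist_eq_2:
  assumes "adj x z" "adj z y" "x \<noteq> y" "\<not> adj x y"
  shows "dist x y = 2"
proof -
  have "x \<in> V" "y \<in> V" using assms adjD by blast+
  moreover have "dist x y \<le> 2"
    using dist_adj_le[of y z x] adj_dist[OF assms(1)] assms adj_commute \<open>x \<in> V\<close> by simp
  ultimately show ?thesis using assms dist_eq_0[of x y] dist_eq_1[of x y] by linarith
qed

lemma dist_eq_SucD:
  assumes "u \<in> V" "v \<in> V" "dist u v = Suc n"
  obtains w where "adj u w" "dist w v = n"
proof -
  have "(u, v) \<in> adjacency E ^^ Suc n" using walk_dist[of u v] assms by simp
  then obtain w where w: "(u, w) \<in> adjacency E" "(w, v) \<in> adjacency E ^^ n"
    by (blast dest: relpow_Suc_D2)
  then have "adj u w" by (simp add: adjacency_def adj_def)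
  moreover have "dist w v \<le> n" using w(2) by (rule gdist_le_walk)
  moreover have "Suc n \<le> Suc (dist w v)"
    using dist_adj_le[OF \<open>adj u w\<close> assms(2)] assms(3) by (simp add: gdist_commute)
  ultimately show ?thesis using that by fastforce
qed

lemma common_nbr_in_interval:
  assumes "adj x z" "adj z y" "x \<noteq> y" "\<not> adj x y"
  shows "z \<in> interval V E x y"
  using assms dist_eq_2[OF assms] adj_dist adjD by (auto simp: interval_def)

lemma interval_mono:
  assumes "w \<in> interval V E u v" "u \<in> V" "v \<in> V"
  shows "interval V E w v \<subseteq> interval V E u v"
proof
  fix x assume x: "x \<in> interval V E w v"
  have "dist u v \<le> dist u x + dist x v" "dist u x \<le> dist u w + dist w x"
    using dist_triangle x assms by (auto simp: interval_def)
  with x assms show "x \<in> interval V E u v" by (auto simp: interval_def)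
qed

lemma interval_ends: "u \<in> V \<Longrightarrow> v \<in> V \<Longrightarrow> u \<in> interval V E u v \<and> v \<in> interval V E u v"
  by (simp add: interval_def)

lemma geodesic_within:
  assumes "u \<in> V" "v \<in> V" "interval V E u v \<subseteq> A"
  shows "(u, v) \<in> (adjacency E \<inter> A \<times> A) ^^ dist u v"
  using assms
proof (induction "dist u v" arbitrary: u)
  case 0
  then show ?case using dist_eq_0[of u v] by simp
next
  case (Suc n)
  then obtain w where w: "adj u w" "dist w v = n" using dist_eq_SucD[of u v n] by metis
  then have "w \<in> interval V E u v"
    using Suc.hyps(2) adjD adj_dist by (auto simp: interval_def)
  then have "interval V E w v \<subseteq> A" "w \<in> A" "u \<in> A"
    using interval_mono[of w u v] interval_ends[of u v] Suc.prems by auto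
  then have "(w, v) \<in> (adjacency E \<inter> A \<times> A) ^^ n" "(u, w) \<in> adjacency E \<inter> A \<times> A"
    using Suc.hyps(1)[of w] w adjD[OF w(1)] Suc.prems
    by (auto simp: adjacency_def adj_def)
  then show ?case using Suc.hyps(2) by (metis relpow_Suc_I2)
qed

text \<open>The sets whose convexity is at stake contain the geodesics from their members to some centre, which
  is how they are seen to be connected.\<close>

lemma star_shaped_connected:
  assumes "c \<in> V" "A \<subseteq> V" "\<And>x. x \<in> A \<Longrightarrow> interval V E c x \<subseteq> A" "x \<in> A" "y \<in> A"
  shows "(x, y) \<in> (adjacency E \<inter> A \<times> A)\<^sup>*"
proof -
  let ?R = "adjacency E \<inter> A \<times> A"
  have R: "(c, z) \<in> ?R\<^sup>*" if "z \<in> A" for z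
    using geodesic_within[of c z A] assms that by (meson relpow_imp_rtrancl subsetD)
  have "sym ?R" by (auto simp: sym_def adjacency_def insert_commute)
  then have "(x, c) \<in> ?R\<^sup>*" using R[OF \<open>x \<in> A\<close>] by (meson sym_rtrancl symD)
  with R[OF \<open>y \<in> A\<close>] show ?thesis by simp
qed

end

section \<open>Weakly bridged graphs\<close>

locale weakly_bridged_graph = connected_graph +
  assumes weakly_bridged: "weakly_bridged V E"
begin

lemma triangle_cond:
  assumes "adj x y" "s \<in> V" "dist s x = dist s y"
  obtains t where "adj t x" "adj t y" "Suc (dist s t) = dist s x"
proof -
  have "triangle_condition V E"
    using weakly_bridged by (simp add: weakly_bridged_def weakly_modular_def)
  moreover have "x \<in> V" "y \<in> V" "dist x y = 1" "dist x s = dist y s"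
    using assms adjD adj_dist by (auto simp: gdist_commute)
  ultimately obtain t where "{t, x} \<in> E" "{t, y} \<in> E" "Suc (dist s t) = dist s x"
    using \<open>s \<in> V\<close> unfolding triangle_condition_def by metis
  then show ?thesis using that by (simp add: adj_def)
qed

lemma ball_convex:
  assumes "s \<in> V" "adj x z" "adj z y" "x \<noteq> y" "\<not> adj x y" "dist s x \<le> k" "dist s y \<le> k"
  shows "dist s z \<le> k"
proof -
  have "gconvex V E (gball V E s k)" using weakly_bridged \<open>s \<in> V\<close> by (simp add: weakly_bridged_def)
  moreover have "x \<in> gball V E s k" "y \<in> gball V E s k"
    using assms adjD by (auto simp: gball_def)
  ultimately have "z \<in> gball V E s k"
    using common_nbr_in_interval[of x z y] assms by (auto simp: gconvex_def)
  then show ?thesis by (simp add: gball_def)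
qed

lemma closer_nbrs_adj:
  assumes "s \<in> V" "adj p w" "adj q w" "p \<noteq> q" "dist s p < dist s w" "dist s q < dist s w"
  shows "adj p q"
  using ball_convex[of s p w q "dist s w - 1"] assms adj_commute by fastforce

text \<open>The ball of radius 1 around \<open>b\<close> is convex and contains \<open>x\<close> and \<open>y\<close>, hence also \<open>c\<close>.\<close>

lemma no_induced_C4:
  assumes "adj x b" "adj b y" "adj y c" "adj c x" "x \<noteq> y" "\<not> adj x y" "b \<noteq> c"
  shows "adj b c"
proof -
  have V: "b \<in> V" "c \<in> V" using assms adjD by blast+
  have "dist b c \<le> 1"
    using ball_convex[of b x c y 1] assms V adj_dist[of b] adj_commute by (metis order_refl)
  then show ?thesis using V assms(7) dist_eq_1[of b c] dist_eq_0[of b c] by linarith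
qed

text \<open>The induction is on the length of a walk inside \<open>A\<close>.  With \<open>x\<^sub>1\<close> the second vertex of the walk,
  \<open>I(x\<^sub>1, y) \<subseteq> A\<close> holds by induction, and only the case \<open>d(x, y) = d(x\<^sub>1, y) + 1\<close> needs the local
  hypothesis.  There a vertex \<open>p\<close> of \<open>I(x, y)\<close> is reached through a neighbour \<open>x'\<close> of \<open>x\<close>
  that is closer to \<open>y\<close>, so \<open>x'\<close> is equal or adjacent to \<open>x\<^sub>1\<close>.  The triangle condition for the edge
  \<open>x' x\<^sub>1\<close> yields \<open>z \<in> I(x\<^sub>1, y)\<close>, and \<open>x'\<close> is a common neighbour of \<open>x\<close> and \<open>z\<close>, which both lie
  in \<open>A\<close>.\<close>

lemma interval_subset_of_walk:
  assumes "A \<subseteq> V"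
    and local: "\<And>x y z. x \<in> A \<Longrightarrow> y \<in> A \<Longrightarrow> adj x z \<Longrightarrow> adj z y \<Longrightarrow> x \<noteq> y \<Longrightarrow> \<not> adj x y \<Longrightarrow> z \<in> A"
    and "x \<in> A" "y \<in> A" "(x, y) \<in> (adjacency E \<inter> A \<times> A) ^^ n"
  shows "interval V E x y \<subseteq> A"
  using assms(3-5)
proof (induction n arbitrary: x rule: less_induct)
  case (less n)
  let ?R = "adjacency E \<inter> A \<times> A"
  have V: "x \<in> V" "y \<in> V" using less.prems \<open>A \<subseteq> V\<close> by auto
  show ?case
  proof (cases n)
    case 0
    then have "x = y" using less.prems by simp
    then show ?thesis using V less.prems by (auto simp: interval_def)
  next
    case (Suc m)
    then obtain x1 where x1: "(x, x1) \<in> ?R" "(x1, y) \<in> ?R ^^ m"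
      using less.prems by (metis relpow_Suc_D2)
    then have "adj x x1" "x1 \<in> A" by (auto simp: adjacency_def adj_def)
    then have "x1 \<in> V" using \<open>A \<subseteq> V\<close> by auto
    have I1: "interval V E x1 y \<subseteq> A" using less.IH[of m x1] x1 \<open>x1 \<in> A\<close> less.prems Suc by simp
    have "dist x1 y \<le> m"
    proof -
      have "(x1, y) \<in> adjacency E ^^ m" using x1(2) by (rule walk_mono) blast
      then show ?thesis by (rule gdist_le_walk)
    qed
    \<comment> \<open>The detour through \<open>z\<close> gives a walk from \<open>x'\<close> to \<open>y\<close> short enough for the induction.\<close>
    have close: "interval V E x' y \<subseteq> A"
      if "x' \<in> A" "adj x' z" "z \<in> interval V E x1 y" "Suc (dist z y) = dist x1 y" for x' z
    proof -
      have "z \<in> V" "interval V E z y \<subseteq> A" "z \<in> A"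
        using that(3) I1 interval_mono[of z x1 y] \<open>x1 \<in> V\<close> V by (auto simp: interval_def)
      then have "(z, y) \<in> ?R ^^ dist z y" using geodesic_within V by blast
      moreover have "(x', z) \<in> ?R" using that \<open>z \<in> A\<close> by (auto simp: adjacency_def adj_def)
      ultimately have "(x', y) \<in> ?R ^^ Suc (dist z y)" by (rule relpow_Suc_I2[rotated])
      then show ?thesis
        using less.IH[of "Suc (dist z y)" x'] that \<open>dist x1 y \<le> m\<close> Suc less.prems by simp
    qed
    consider "Suc (dist x y) = dist x1 y" | "dist y x = dist y x1" | "dist x y = Suc (dist x1 y)"
      using dist_adj_le[OF \<open>adj x x1\<close> V(2)] dist_adj_le[of x1 x y] \<open>adj x x1\<close> adj_commute V
      by (metis gdist_commute le_Suc_eq le_antisym not_less_eq_eq)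
    then show ?thesis
    proof cases
      case 1
      then have "x \<in> interval V E x1 y"
        using V adj_dist[OF \<open>adj x x1\<close>] by (simp add: interval_def gdist_commute)
      then show ?thesis using interval_mono[of x x1 y] \<open>x1 \<in> V\<close> V I1 by blast
    next
      case 2
      then obtain z where z: "adj z x" "adj z x1" "Suc (dist y z) = dist y x"
        using triangle_cond[OF \<open>adj x x1\<close> V(2)] by metis
      then have "z \<in> interval V E x1 y" "Suc (dist z y) = dist x1 y"
        using adj_dist[OF z(2)] adjD[OF z(1)] 2 by (auto simp: interval_def gdist_commute)
      then show ?thesis using close[of x z] z less.prems adj_commute by blast
    next
      case 3
      show ?thesis
      proof
        fix p assume p: "p \<in> interval V E x y"
        show "p \<in> A"
        proof (cases "p = x")
          case True
          then show ?thesis using less.prems by simp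
        next
          case False
          have pV: "p \<in> V" using p by (simp add: interval_def)
          then obtain k where "dist x p = Suc k" using False V dist_eq_0[of x p] not0_implies_Suc by metis
          then obtain x' where x': "adj x x'" "dist x' p = k" using dist_eq_SucD V pV by metis
          have x'V: "x' \<in> V" using x' adjD by blast
          have "Suc (dist x' y) \<le> dist x y"
            using dist_triangle[OF x'V pV V(2)] p x' \<open>dist x p = Suc k\<close> by (simp add: interval_def)
          moreover have "dist x y \<le> Suc (dist x' y)"
            using dist_adj_le[OF x'(1) V(2)] by (simp add: gdist_commute)
          ultimately have dx': "dist x y = Suc (dist x' y)" by simp
          have pI: "p \<in> interval V E x' y"
            using p x' dx' \<open>dist x p = Suc k\<close> pV by (simp add: interval_def)
          show ?thesis
          proof (cases "x' = x1")
            case True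
            then show ?thesis using pI I1 by blast
          next
            case False
            then have "adj x' x1"
              using closer_nbrs_adj[of y x' x x1] x' \<open>adj x x1\<close> adj_commute V 3 dx'
              by (simp add: gdist_commute)
            then obtain z where z: "adj z x'" "adj z x1" "Suc (dist y z) = dist y x'"
              using triangle_cond[of x' x1 y] V 3 dx' by (auto simp: gdist_commute)
            then have zI: "z \<in> interval V E x1 y" "Suc (dist z y) = dist x1 y"
              using adj_dist[OF z(2)] adjD[OF z(1)] 3 dx' by (auto simp: interval_def gdist_commute)
            then have "z \<in> A" using I1 by blast
            have "x \<noteq> z \<and> \<not> adj x z"
              using dist_adj_le[of x z y] V 3 zI(2) by (auto simp: gdist_commute)
            then have "x' \<in> A"
              using local[of x z x'] less.prems \<open>z \<in> A\<close> x' z adj_commute by blast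
            then show ?thesis using close[of x' z] z zI pI adj_commute by blast
          qed
        qed
      qed
    qed
  qed
qed

lemma locally_convex_imp_convex:
  assumes "A \<subseteq> V"
    and "\<And>x y. x \<in> A \<Longrightarrow> y \<in> A \<Longrightarrow> (x, y) \<in> (adjacency E \<inter> A \<times> A)\<^sup>*"
    and "\<And>x y z. x \<in> A \<Longrightarrow> y \<in> A \<Longrightarrow> adj x z \<Longrightarrow> adj z y \<Longrightarrow> x \<noteq> y \<Longrightarrow> \<not> adj x y \<Longrightarrow> z \<in> A"
  shows "gconvex V E A"
  unfolding gconvex_def using interval_subset_of_walk[of A] assms rtrancl_power by metis


end

section \<open>The forbidden subgraphs\<close>

text \<open>The propeller is the complete graph on five vertices without the triangle on \<open>2, 3, 4\<close>.\<close>

definition propeller_dist :: "nat \<Rightarrow> nat \<Rightarrow> nat" where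
  "propeller_dist x y = (if x = y then 0 else if x < 2 \<or> y < 2 then 1 else 2)"

lemma propeller_vertex_iff: "x \<in> propeller_verts \<longleftrightarrow> x < 5"
  by (auto simp: propeller_verts_def)

lemma propeller_edge_iff: "{x, y} \<in> propeller_edges \<longleftrightarrow> x < 5 \<and> y < 5 \<and> propeller_dist x y = 1"
proof
  assume "{x, y} \<in> propeller_edges"
  then show "x < 5 \<and> y < 5 \<and> propeller_dist x y = 1"
    by (auto simp: propeller_edges_def propeller_dist_def doubleton_eq_iff)
next
  have mem: "{i, j} \<in> propeller_edges" if "i < 2" "j < 5" "i \<noteq> j" for i j
  proof (cases "j < 2")
    case True
    then have "{i, j} = {0, 1}" using that by (auto simp: less_2_cases_iff)
    then show ?thesis by (simp add: propeller_edges_def)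
  next
    case False
    then have "i \<in> {0, 1}" "j \<in> {2, 3, 4}" using that by auto
    then show ?thesis unfolding propeller_edges_def by blast
  qed
  assume "x < 5 \<and> y < 5 \<and> propeller_dist x y = 1"
  then have "x < 5" "y < 5" "x \<noteq> y" "x < 2 \<or> y < 2"
    by (auto simp: propeller_dist_def split: if_splits)
  then show "{x, y} \<in> propeller_edges" using mem[of x y] mem[of y x] by (auto simp: insert_commute)
qed

lemma gdist_propeller:
  assumes "x \<in> propeller_verts" "y \<in> propeller_verts"
  shows "gdist propeller_edges x y = propeller_dist x y"
proof (rule gdist_eqI[where S = propeller_verts])
  show "propeller_dist x x = 0" by (simp add: propeller_dist_def)
  show "propeller_dist x z \<le> Suc (propeller_dist x y)" if "{y, z} \<in> propeller_edges" for y z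
    using that by (auto simp: propeller_edge_iff propeller_dist_def split: if_splits)
  show "y = x" if "propeller_dist x y = 0" for y
    using that by (simp add: propeller_dist_def split: if_splits)
  show "\<exists>z\<in>propeller_verts. {z, y} \<in> propeller_edges \<and> propeller_dist x z = n"
    if "y \<in> propeller_verts" "propeller_dist x y = Suc n" for y n
  proof (cases "n = 0")
    case True
    then show ?thesis
      using assms(1) that
      by (intro bexI[of _ x]) (simp_all add: propeller_vertex_iff propeller_edge_iff propeller_dist_def)
  next
    case False
    then have "n = 1" "2 \<le> x" "2 \<le> y"
      using that by (auto simp: propeller_dist_def split: if_splits)
    then show ?thesis
      using assms(1) that
      by (intro bexI[of _ 0]) (simp_all add: propeller_vertex_iff propeller_edge_iff propeller_dist_def)
  qed
qed fact

definition R1_dist :: "R1_vertex \<Rightarrow> R1_vertex \<Rightarrow> nat" where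
  "R1_dist x y = (case x of
     Ru \<Rightarrow> (case y of Ru \<Rightarrow> 0 | Rv \<Rightarrow> 1 | Rx \<Rightarrow> 2 | Ra \<Rightarrow> 2 | Rb \<Rightarrow> 1 | Rw \<Rightarrow> 2 | Ry \<Rightarrow> 3)
   | Rv \<Rightarrow> (case y of Ru \<Rightarrow> 1 | Rv \<Rightarrow> 0 | Rx \<Rightarrow> 1 | Ra \<Rightarrow> 1 | Rb \<Rightarrow> 1 | Rw \<Rightarrow> 2 | Ry \<Rightarrow> 2)
   | Rx \<Rightarrow> (case y of Ru \<Rightarrow> 2 | Rv \<Rightarrow> 1 | Rx \<Rightarrow> 0 | Ra \<Rightarrow> 1 | Rb \<Rightarrow> 1 | Rw \<Rightarrow> 1 | Ry \<Rightarrow> 2)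
   | Ra \<Rightarrow> (case y of Ru \<Rightarrow> 2 | Rv \<Rightarrow> 1 | Rx \<Rightarrow> 1 | Ra \<Rightarrow> 0 | Rb \<Rightarrow> 1 | Rw \<Rightarrow> 1 | Ry \<Rightarrow> 1)
   | Rb \<Rightarrow> (case y of Ru \<Rightarrow> 1 | Rv \<Rightarrow> 1 | Rx \<Rightarrow> 1 | Ra \<Rightarrow> 1 | Rb \<Rightarrow> 0 | Rw \<Rightarrow> 1 | Ry \<Rightarrow> 2)
   | Rw \<Rightarrow> (case y of Ru \<Rightarrow> 2 | Rv \<Rightarrow> 2 | Rx \<Rightarrow> 1 | Ra \<Rightarrow> 1 | Rb \<Rightarrow> 1 | Rw \<Rightarrow> 0 | Ry \<Rightarrow> 1)
   | Ry \<Rightarrow> (case y of Ru \<Rightarrow> 3 | Rv \<Rightarrow> 2 | Rx \<Rightarrow> 2 | Ra \<Rightarrow> 1 | Rb \<Rightarrow> 2 | Rw \<Rightarrow> 1 | Ry \<Rightarrow> 0))"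

lemma R1_edge_iff: "{x, y} \<in> R1_edges \<longleftrightarrow> R1_dist x y = 1"
  by (cases x; cases y; simp add: R1_dist_def R1_edges_def doubleton_eq_iff)

lemma ex_R1_vertex: "(\<exists>z. P z) \<longleftrightarrow> P Ru \<or> P Rv \<or> P Rx \<or> P Ra \<or> P Rb \<or> P Rw \<or> P Ry"
  by (metis R1_vertex.exhaust)

lemma gdist_R1: "gdist R1_edges x y = R1_dist x y"
proof (rule gdist_eqI[where S = UNIV])
  show "R1_dist x x = 0" by (cases x; simp add: R1_dist_def)
  show "R1_dist x z \<le> Suc (R1_dist x y)" if "{y, z} \<in> R1_edges" for y z
    using that unfolding R1_edge_iff by (cases x; cases y; cases z; simp add: R1_dist_def)
  show "y = x" if "R1_dist x y = 0" for y
    using that by (cases x; cases y; simp add: R1_dist_def)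
  show "\<exists>z\<in>UNIV. {z, y} \<in> R1_edges \<and> R1_dist x z = n" if "R1_dist x y = Suc n" for y n
    using that unfolding R1_edge_iff ex_R1_vertex
    by (cases x; cases y; simp add: R1_dist_def ex_R1_vertex)
qed simp

context connected_graph
begin

text \<open>Nonadjacency is mostly read off from distances to a fixed vertex.\<close>

lemma level_gap:
  assumes "s \<in> V" "Suc (dist s x) < dist s y"
  shows "x \<noteq> y" "y \<noteq> x" "\<not> adj x y" "\<not> adj y x"
  using assms dist_adj_le[of x y s] dist_adj_le[of y x s] by (auto simp: adj_commute)

lemma contains_propellerI:
  assumes "adj a b" "adj a c" "adj b c" "adj a c'" "adj b c'" "adj a c''" "adj b c''"
    and "c \<noteq> c'" "\<not> adj c c'" "c \<noteq> c''" "\<not> adj c c''" "c' \<noteq> c''" "\<not> adj c' c''"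
  shows "contains_isometric V E propeller_verts propeller_edges"
proof -
  define f where "f i = [a, b, c, c', c''] ! i" for i
  have f [simp]: "f 0 = a" "f (Suc 0) = b" "f 2 = c" "f 3 = c'" "f 4 = c''"
    by (simp_all add: f_def)
  have 1: "dist a b = 1" "dist a c = 1" "dist b c = 1" "dist a c' = 1" "dist b c' = 1"
    "dist a c'' = 1" "dist b c'' = 1"
    using assms adj_dist by auto
  have 2: "dist c c' = 2" "dist c c'' = 2" "dist c' c'' = 2"
    using assms dist_eq_2[of _ a] adj_commute by auto
  have "f ` propeller_verts \<subseteq> V"
    using assms adjD by (auto simp: propeller_verts_def)
  moreover have "dist (f x) (f y) = gdist propeller_edges x y"
    if "x \<in> propeller_verts" "y \<in> propeller_verts" for x y
  proof -
    have "x = 0 \<or> x = 1 \<or> x = 2 \<or> x = 3 \<or> x = 4" "y = 0 \<or> y = 1 \<or> y = 2 \<or> y = 3 \<or> y = 4"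
      using that by (auto simp: propeller_verts_def)
    then show ?thesis
      unfolding gdist_propeller[OF that] using 1 2
      by (elim disjE; simp add: propeller_dist_def gdist_commute)
  qed
  ultimately show ?thesis unfolding contains_isometric_def by blast
qed

text \<open>The edges, the distance between the two ends \<open>u\<close> and \<open>y\<close>, and three missing edges determine the
  distances of all other pairs.\<close>

lemma contains_R1I:
  assumes edges: "adj u v" "adj v x" "adj x a" "adj a y" "adj y w" "adj w b" "adj b u"
      "adj v b" "adj b a" "adj a w" "adj w x" "adj x b" "adj v a"
    and uy: "3 \<le> dist u y"
    and "\<not> adj u x" "\<not> adj y x" "\<not> adj v w"
  shows "contains_isometric V E (UNIV :: R1_vertex set) R1_edges"
proof -
  define f where "f z = (case z of Ru \<Rightarrow> u | Rv \<Rightarrow> v | Rx \<Rightarrow> x | Ra \<Rightarrow> a | Rb \<Rightarrow> b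
    | Rw \<Rightarrow> w | Ry \<Rightarrow> y)" for z
  have V: "u \<in> V" "v \<in> V" "x \<in> V" "a \<in> V" "b \<in> V" "w \<in> V" "y \<in> V"
    using edges adjD by blast+
  have two: "dist p q = 2" if "\<not> adj p q" "p \<noteq> q" "adj p r" "adj r q" for p q r
    using dist_eq_2 that by blast
  have lev: "dist u v = 1" "dist u b = 1" "dist u a \<le> 2" "dist u x \<le> 2" "dist u w \<le> 2"
    using adj_dist[of u] edges adj_commute dist_adj_le[of a v u] dist_adj_le[of x v u]
      dist_adj_le[of w b u] V by auto
  have w: "2 \<le> dist u w" and a: "2 \<le> dist u a"
    using dist_adj_le[of y w u] dist_adj_le[of y a u] edges adj_commute uy V by auto
  have "dist u y = 3" "dist u a = 2" "dist u w = 2"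
    using uy w a lev dist_adj_le[of y w u] edges V by auto
  moreover have "u \<noteq> x" "y \<noteq> x" "v \<noteq> w"
    using lev uy w edges V adj_dist[of u w] adj_commute by force+
  then have "dist u x = 2" "dist y x = 2" "dist v w = 2"
    using two[of u x v] two[of y x a] two[of v w b] assms adj_commute by auto
  moreover have "dist y v = 2" "dist y b = 2"
    using two[of y v a] two[of y b a] level_gap[of u v y] level_gap[of u b y] lev uy edges V
      adj_commute by auto
  moreover note edges[THEN adj_dist]
  ultimately have "dist (f p) (f q) = R1_dist p q" for p q
    by (cases p; cases q; simp add: f_def R1_dist_def gdist_commute)
  moreover have "range f \<subseteq> V" using V by (auto simp: f_def split: R1_vertex.splits)
  ultimately show ?thesis unfolding contains_isometric_def gdist_R1 by blast
qed

end

section \<open>Convexity from forbidden subgraphs\<close>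

context weakly_bridged_graph
begin

text \<open>Let \<open>z\<close> be a common neighbour outside \<open>I(u, v)\<close> of two nonadjacent members \<open>x, y\<close>.  By convexity of
  balls around \<open>u\<close> and \<open>v\<close>, the vertices \<open>x\<close> and \<open>y\<close> are in consecutive levels of the interval, while
  \<open>z\<close> is as far from \<open>u\<close> as \<open>y\<close> and as far from \<open>v\<close> as \<open>x\<close>.  The triangle condition gives \<open>b\<close> below
  \<open>y z\<close> (towards \<open>u\<close>) and \<open>c\<close> above \<open>x z\<close> (towards \<open>v\<close>).  The vertices \<open>x, b, c, y, z\<close> induce the
  complete graph without the edge \<open>x y\<close>, and a further step down from \<open>x b\<close> and up from \<open>c y\<close>
  completes \<open>R\<^sub>1\<close>.  The two ends of this \<open>R\<^sub>1\<close> are at distance 3 and lie on a geodesic from \<open>u\<close> to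
  \<open>v\<close>, so this cannot happen for \<open>d(u, v) \<le> 2\<close>.\<close>

lemma interval_convex:
  assumes "u \<in> V" "v \<in> V"
    and small: "dist u v \<le> 2 \<or> \<not> contains_isometric V E (UNIV :: R1_vertex set) R1_edges"
  shows "gconvex V E (interval V E u v)"
proof (rule locally_convex_imp_convex)
  let ?I = "interval V E u v"
  show "?I \<subseteq> V" by (auto simp: interval_def)
  show "(x, y) \<in> (adjacency E \<inter> ?I \<times> ?I)\<^sup>*" if "x \<in> ?I" "y \<in> ?I" for x y
  proof (rule star_shaped_connected[OF \<open>v \<in> V\<close> \<open>?I \<subseteq> V\<close> _ that])
    show "interval V E v z \<subseteq> ?I" if "z \<in> ?I" for z
      using interval_mono[OF that \<open>u \<in> V\<close> \<open>v \<in> V\<close>]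
      by (auto simp: interval_def gdist_commute add.commute)
  qed
  have I_iff: "z \<in> ?I \<longleftrightarrow> dist u z + dist v z \<le> dist u v" if "z \<in> V" for z
    using that dist_triangle[of u z v] \<open>u \<in> V\<close> \<open>v \<in> V\<close>
    by (auto simp: interval_def gdist_commute)
  \<comment> \<open>The roles of \<open>x\<close> and \<open>y\<close> are interchangeable, so \<open>x\<close> is taken to be the one nearer to \<open>u\<close>.\<close>
  have main: "z \<in> ?I"
    if xy: "x \<in> ?I" "y \<in> ?I" "adj x z" "adj z y" "x \<noteq> y" "\<not> adj x y"
      and le: "dist u x \<le> dist u y" for x y z
  proof (rule ccontr)
    assume z: "z \<notin> ?I"
    have V: "x \<in> V" "y \<in> V" "z \<in> V" using xy adjD by blast+
    have sx: "dist u x + dist v x = dist u v" and sy: "dist u y + dist v y = dist u v"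
      using xy by (auto simp: interval_def gdist_commute)
    have zgt: "dist u v < dist u z + dist v z" using z I_iff V by simp
    have "dist u z \<le> dist u y" "dist v z \<le> dist v x"
      using ball_convex[of u x z y "dist u y"] ball_convex[of v x z y "dist v x"] xy le sx sy assms
      by auto
    moreover have "dist u z \<le> Suc (dist u x)" "dist v z \<le> Suc (dist v y)"
      using dist_adj_le[of z x u] dist_adj_le[of z y v] xy adj_commute assms by auto
    ultimately have lev: "dist u z = dist u y" "dist v z = dist v x" "dist u y = Suc (dist u x)"
      "dist v x = Suc (dist v y)"
      using zgt sx sy by auto
    obtain b where b: "adj b z" "adj b y" "Suc (dist u b) = dist u z"
      using triangle_cond[of z y u] xy lev assms by auto
    obtain c where c: "adj c z" "adj c x" "Suc (dist v c) = dist v z"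
      using triangle_cond[of z x v] xy lev assms adj_commute by metis
    have "adj x b"
      using closer_nbrs_adj[of u x z b] b xy lev assms by auto
    have "adj y c"
      using closer_nbrs_adj[of v y z c] c xy lev assms adj_commute[of y] by auto
    \<comment> \<open>Otherwise a walk through \<open>b\<close> would be a shortcut from \<open>u\<close> to \<open>v\<close>.\<close>
    have "b \<noteq> c"
      using sx lev b c dist_triangle[of u b v] adjD[OF b(1)] assms
      by (auto simp: gdist_commute[of E b v])
    then have "adj b c"
      using no_induced_C4[of x b y c] \<open>adj x b\<close> \<open>adj y c\<close> b c xy adj_commute by blast
    obtain u' where u': "adj u' x" "adj u' b" "Suc (dist u u') = dist u x"
      using triangle_cond[OF \<open>adj x b\<close> \<open>u \<in> V\<close>] lev b by auto
    obtain v' where v': "adj v' y" "adj v' c" "Suc (dist v v') = dist v y"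
      using triangle_cond[OF \<open>adj y c\<close> \<open>v \<in> V\<close>] lev c by auto
    have V': "u' \<in> V" "v' \<in> V" using u' v' adjD by blast+
    have "dist u v \<le> dist u u' + (dist u' v' + dist v v')"
      using dist_triangle[of u u' v] dist_triangle[of u' v' v] V' assms
      by (simp add: gdist_commute)
    then have "3 \<le> dist u' v'" using u' v' sx lev by linarith
    have "contains_isometric V E (UNIV :: R1_vertex set) R1_edges"
    proof (rule contains_R1I[of u' x z c v' y b])
      show "3 \<le> dist u' v'" by fact
      show "\<not> adj u' z" using level_gap[of u u' z] u' lev assms by auto
      show "\<not> adj v' z" using level_gap[of v v' z] v' lev assms by auto
    qed (use \<open>adj x b\<close> \<open>adj y c\<close> \<open>adj b c\<close> u' v' b c xy in \<open>simp_all add: adj_commute\<close>)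
    with small have "dist u v \<le> 2" by blast
    then show False using sx lev u' v' by linarith
  qed
  show "z \<in> ?I" if "x \<in> ?I" "y \<in> ?I" "adj x z" "adj z y" "x \<noteq> y" "\<not> adj x y" for x y z
  proof (cases "dist u x \<le> dist u y")
    case True
    with that show ?thesis by (intro main[of x y z])
  next
    case False
    then have "dist u y \<le> dist u x" by simp
    with that show ?thesis by (intro main[of y x z]) (simp_all add: adj_commute)
  qed
qed

lemma gconv_pair:
  assumes "u \<in> V" "v \<in> V"
    and "dist u v \<le> 2 \<or> \<not> contains_isometric V E (UNIV :: R1_vertex set) R1_edges"
  shows "gconv V E {u, v} = interval V E u v"
  unfolding gconv_def
proof (rule hull_unique)
  show "{u, v} \<subseteq> interval V E u v" using interval_ends assms by auto
  show "gconvex V E (interval V E u v)" by (rule interval_convex[OF assms])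
  show "interval V E u v \<subseteq> T" if "{u, v} \<subseteq> T" "gconvex V E T" for T
    using that by (simp add: gconvex_def)
qed

lemma interval_subset_gconv: "interval V E u v \<subseteq> gconv V E {u, v}"
proof -
  have "interval V E u v \<subseteq> T" if "gconvex V E T" "{u, v} \<subseteq> T" for T
    using that by (simp add: gconvex_def)
  then show ?thesis unfolding gconv_def hull_def by (intro Inter_greatest) simp
qed

text \<open>Let \<open>z\<close> be a common neighbour outside the shadow \<open>A\<close> of two nonadjacent members \<open>x, y\<close>, with \<open>y\<close> not
  nearer to \<open>u\<close> than \<open>x\<close>.  Then \<open>z\<close> is one step nearer to \<open>u\<close> than \<open>y\<close>, but as far from \<open>v\<close> as \<open>y\<close>.
  Towards \<open>v\<close> there is a common neighbour \<open>p \<in> A\<close> of \<open>z\<close> and \<open>y\<close>; it is as far from \<open>u\<close> as \<open>z\<close>.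

  If \<open>x\<close> is also as far from \<open>v\<close> as \<open>y\<close> and is adjacent to \<open>p\<close>, then \<open>x\<close>, \<open>y\<close> and a common neighbour
  of \<open>z\<close> and \<open>p\<close> towards \<open>u\<close> form a propeller with axis \<open>z p\<close>.  In all other cases there is an edge
  \<open>p q\<close> in \<open>A\<close> below \<open>z\<close> (seen from \<open>v\<close>), and one of \<open>x, y\<close> is a common neighbour \<open>e\<close> of \<open>z\<close> and one
  end of this edge, but not adjacent to the other end; this configuration is the subject of the step
  \<open>fan\<close>.\<close>

lemma distance_point_shadow_convex:
  assumes "u \<in> V" "v \<in> V"
    and no_propeller: "\<not> contains_isometric V E propeller_verts propeller_edges"
    and no_R1: "\<not> contains_isometric V E (UNIV :: R1_vertex set) R1_edges"
  shows "gconvex V E (distance_point_shadow V E v u)"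
proof (rule locally_convex_imp_convex)
  let ?A = "distance_point_shadow V E v u"
  have A_iff: "z \<in> ?A \<longleftrightarrow> z \<in> V \<and> dist u z = dist u v + dist v z" for z
    using \<open>v \<in> V\<close> by (auto simp: distance_point_shadow_def interval_def)
  have tri: "dist u z \<le> dist u v + dist v z" if "z \<in> V" for z
    using dist_triangle[OF \<open>u \<in> V\<close> \<open>v \<in> V\<close> that] .
  show "?A \<subseteq> V" using A_iff by blast
  \<comment> \<open>\<open>A\<close> is closed under steps towards \<open>v\<close>.\<close>
  have down: "t \<in> ?A" if "z \<in> ?A" "adj t z" "Suc (dist v t) = dist v z" for t z
    using that A_iff[of z] A_iff[of t] tri[of t] dist_adj_le[of z t u] adj_commute adjD[of t z] assms
    by auto
  show "(x, y) \<in> (adjacency E \<inter> ?A \<times> ?A)\<^sup>*" if "x \<in> ?A" "y \<in> ?A" for x y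
  proof (rule star_shaped_connected[OF \<open>v \<in> V\<close> \<open>?A \<subseteq> V\<close> _ that])
    show "interval V E v z \<subseteq> ?A" if "z \<in> ?A" for z
    proof
      fix t assume t: "t \<in> interval V E v z"
      then have "t \<in> V" "z \<in> V" using that A_iff by (auto simp: interval_def)
      then show "t \<in> ?A"
        using t that A_iff tri[of t] dist_triangle[of u t z] assms by (auto simp: interval_def)
    qed
  qed
  \<comment> \<open>Without propellers, a common neighbour of an edge is adjacent to one of any two nonadjacent ones.\<close>
  have third_nbr: "adj s c \<or> adj s e"
    if "adj a b" "adj c a" "adj c b" "adj e a" "adj e b" "adj s a" "adj s b"
      "c \<noteq> e" "\<not> adj c e" "s \<noteq> c" "s \<noteq> e" for a b c e s
    using contains_propellerI[of a b c e s] no_propeller that adj_commute by metis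
  \<comment> \<open>The vertices \<open>t\<close> (towards \<open>u\<close> from \<open>z p\<close>) and \<open>r\<close> (towards \<open>v\<close> from \<open>p q\<close>) form with
    \<open>z, p, q\<close> the complete graph without the edge \<open>z r\<close>; together with \<open>e\<close> on one side and
    a vertex \<open>s\<close> (towards \<open>u\<close> from \<open>r t\<close>) on the other it is \<open>R\<^sub>1\<close>.  Here \<open>t\<close> and \<open>q\<close> are adjacent
    because otherwise \<open>e, q, t\<close> would form a propeller with axis \<open>z p\<close>.\<close>
  have fan: False
    if adj: "adj z p" "adj p q" "adj q z" "adj e z" "adj e p"
      and eq: "e \<noteq> q" "\<not> adj e q"
      and pA: "p \<in> ?A" and qA: "q \<in> ?A"
      and lev: "dist u p = dist u z" "dist u q = dist u z" "dist u e = Suc (dist u z)"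
        "dist v p = dist v q" "dist v z = Suc (dist v p)" for z p q e
  proof -
    have V: "p \<in> V" "q \<in> V" "z \<in> V" "e \<in> V" using adj adjD by blast+
    obtain t where t: "adj t z" "adj t p" "Suc (dist u t) = dist u z"
      using triangle_cond[of z p u] adj lev assms by auto
    have te: "t \<noteq> e" "\<not> adj t e" using level_gap[of u t e] t lev assms by auto
    have tq: "t \<noteq> q" using t lev by auto
    have "adj t q"
      using third_nbr[of z p q e t] te tq t adj eq adj_commute by metis
    obtain r where r: "adj r p" "adj r q" "Suc (dist v r) = dist v p"
      using triangle_cond[of p q v] adj lev assms by auto
    have rA: "r \<in> ?A" using down pA r by blast
    have rz: "r \<noteq> z" "\<not> adj r z" using level_gap[of v r z] r lev assms by auto
    have ur: "dist u r = dist u t"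
      using rA pA A_iff r t lev by auto
    have "r \<noteq> t" using rz t by blast
    then have "adj r t"
      using closer_nbrs_adj[of u r p t] r t ur lev assms by auto
    obtain s where s: "adj s r" "adj s t" "Suc (dist u s) = dist u r"
      using triangle_cond[OF \<open>adj r t\<close> \<open>u \<in> V\<close>] ur by auto
    have "s \<in> V" using s adjD by blast
    have "dist u e \<le> dist u s + dist s e" using dist_triangle V \<open>s \<in> V\<close> assms by simp
    then have es: "3 \<le> dist e s" using s ur t lev by (simp add: gdist_commute)
    have "contains_isometric V E (UNIV :: R1_vertex set) R1_edges"
    proof (rule contains_R1I[of e z q t s r p])
      show "3 \<le> dist e s" by fact
      show "\<not> adj s q" using level_gap[of u s q] s ur t lev assms by auto
    qed (use \<open>adj t q\<close> \<open>adj r t\<close> rz s r t adj eq in \<open>simp_all add: adj_commute\<close>)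
    with no_R1 show False by blast
  qed
  have main: "z \<in> ?A"
    if xy: "x \<in> ?A" "y \<in> ?A" "adj x z" "adj z y" "x \<noteq> y" "\<not> adj x y"
      and le: "dist u x \<le> dist u y" for x y z
  proof (rule ccontr)
    assume z: "z \<notin> ?A"
    have V: "x \<in> V" "y \<in> V" "z \<in> V" using xy adjD by blast+
    have sx: "dist u x = dist u v + dist v x" and sy: "dist u y = dist u v + dist v y"
      using xy A_iff by auto
    have zlt: "dist u z < dist u v + dist v z" using z A_iff V tri[of z] by force
    have vz: "dist v z \<le> dist v y"
      using ball_convex[of v x z y "dist v y"] xy le sx sy assms by auto
    have adj1: "dist u y \<le> Suc (dist u z)" "dist u x \<le> Suc (dist u z)"
      using dist_adj_le[of y z u] dist_adj_le[of x z u] xy adj_commute assms by auto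
    have vz': "dist v z \<le> Suc (dist v x)"
      using dist_adj_le[of z x v] xy adj_commute assms by auto
    have lev: "dist u y = Suc (dist u z)" "dist v z = dist v y"
      using vz adj1 zlt sy by auto
    obtain p where p: "adj p z" "adj p y" "Suc (dist v p) = dist v z"
      using triangle_cond[of z y v] xy lev assms by auto
    have pA: "p \<in> ?A" using down[OF xy(2)] p lev by metis
    have up: "dist u p = dist u z" using pA A_iff p lev sy by auto
    show False
    proof (cases "dist v x = dist v y")
      case True
      then have ux: "dist u x = Suc (dist u z)" using sx sy lev by simp
      obtain q where q: "adj q z" "adj q x" "Suc (dist v q) = dist v z"
        using triangle_cond[of z x v] xy lev True assms adj_commute by metis
      have qA: "q \<in> ?A" using down[OF xy(1)] q lev True by metis
      have uq: "dist u q = dist u z" using qA A_iff q lev sy by auto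
      show False
      proof (cases "adj p x")
        case True
        obtain t where t: "adj t z" "adj t p" "Suc (dist u t) = dist u z"
          using triangle_cond[of z p u] p up assms adj_commute by metis
        have "\<not> adj t x" "\<not> adj t y" "t \<noteq> x" "t \<noteq> y"
          using level_gap[of u t x] level_gap[of u t y] t ux lev assms by auto
        then show False
          using third_nbr[of z p x y t] t True p xy adj_commute by blast
      next
        case False
        then have "p \<noteq> q" using q by blast
        then have "adj p q"
          using closer_nbrs_adj[of v p z q] p q assms by auto
        moreover have "x \<noteq> p" using p xy by blast
        ultimately show False
          using fan[of z q p x] p q pA qA up uq ux xy False adj_commute by auto
      qed
    next
      case False
      then have vx: "dist v z = Suc (dist v x)" using vz' lev le sx sy by auto
      have ux: "dist u x = dist u z" using vx lev sx sy by auto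
      have "x \<noteq> p" using p xy by blast
      then have "adj p x"
        using closer_nbrs_adj[of v p z x] p xy vx assms by auto
      then show False
        using fan[of z p x y] p xy pA up ux lev vx adj_commute by auto
    qed
  qed
  show "z \<in> ?A" if "x \<in> ?A" "y \<in> ?A" "adj x z" "adj z y" "x \<noteq> y" "\<not> adj x y" for x y z
  proof (cases "dist u x \<le> dist u y")
    case True
    with that show ?thesis by (intro main[of x y z])
  next
    case False
    then have "dist u y \<le> dist u x" by simp
    with that show ?thesis by (intro main[of y x z]) (simp_all add: adj_commute)
  qed
qed

section \<open>Forbidden subgraphs from convex shadows\<close>

text \<open>The set \<open>C u x\<close> stands for the interval or for the convex hull of \<open>u\<close> and \<open>x\<close>.\<close>

lemma no_forbidden_subgraph:
  assumes convex: "\<And>u v. u \<in> V \<Longrightarrow> v \<in> V \<Longrightarrow> gconvex V E {x \<in> V. v \<in> C u x}"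
    and above: "\<And>u x. u \<in> V \<Longrightarrow> x \<in> V \<Longrightarrow> interval V E u x \<subseteq> C u x"
    and short: "\<And>u x. u \<in> V \<Longrightarrow> x \<in> V \<Longrightarrow> dist u x \<le> 2 \<Longrightarrow> C u x \<subseteq> interval V E u x"
  shows "\<not> contains_isometric V E propeller_verts propeller_edges \<and>
    \<not> contains_isometric V E (UNIV :: R1_vertex set) R1_edges"
proof -
  have step: "dist u v + dist v w = dist u w"
    if V: "u \<in> V" "v \<in> V" "x \<in> V" "y \<in> V" "w \<in> V"
      and "dist u v + dist v x = dist u x" "dist u v + dist v y = dist u y"
      and "dist x w + dist w y = dist x y" "dist u w \<le> 2" for u v x y w
  proof -
    let ?S = "{x \<in> V. v \<in> C u x}"
    have "x \<in> ?S" "y \<in> ?S" using that above[of u x] above[of u y] by (auto simp: interval_def)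
    moreover have "w \<in> interval V E x y" using that by (simp add: interval_def)
    ultimately have "w \<in> ?S" using convex[OF V(1,2)] unfolding gconvex_def by blast
    then show ?thesis using short[of u w] that by (auto simp: interval_def)
  qed
  have "\<not> contains_isometric V E propeller_verts propeller_edges"
  proof
    assume "contains_isometric V E propeller_verts propeller_edges"
    then obtain f where f: "f ` propeller_verts \<subseteq> V"
      "\<forall>x\<in>propeller_verts. \<forall>y\<in>propeller_verts. dist (f x) (f y) = propeller_dist x y"
      unfolding contains_isometric_def using gdist_propeller by metis
    then show False
      \<comment> \<open>The shadow of one axis vertex contains two of the outer vertices, but not the other axis vertex.\<close>
      using step[of "f 2" "f 0" "f 3" "f 4" "f 1"]
      by (simp add: propeller_verts_def propeller_dist_def)
  qed
  moreover have "\<not> contains_isometric V E (UNIV :: R1_vertex set) R1_edges"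
  proof
    assume "contains_isometric V E (UNIV :: R1_vertex set) R1_edges"
    then obtain f where f: "range f \<subseteq> V" "\<forall>x y. dist (f x) (f y) = R1_dist x y"
      unfolding contains_isometric_def gdist_R1 by (elim exE conjE) simp
    have "f x \<in> V" for x using f(1) by (rule subsetD) (rule rangeI)
    then show False
      \<comment> \<open>In the shadow of \<open>v\<close> with respect to \<open>u\<close>, the vertices \<open>x\<close> and \<open>y\<close> have the common
        neighbour \<open>w\<close>, but \<open>v\<close> is not between \<open>u\<close> and \<open>w\<close>.\<close>
      using step[of "f Ru" "f Rv" "f Rx" "f Ry" "f Rw"] f(2)
      by (simp add: R1_dist_def)
  qed
  ultimately show ?thesis ..
qed

end

section \<open>The equivalence\<close>

theorem theorem3:
  fixes V :: "'a set" and E :: "'a set set"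
  assumes "connected_graph V E"
    and "weakly_bridged V E"
  shows "(strongly_smooth V E \<longleftrightarrow> smooth V E) \<and>
    (smooth V E \<longleftrightarrow>
      \<not> contains_isometric V E propeller_verts propeller_edges \<and>
      \<not> contains_isometric V E (UNIV :: R1_vertex set) R1_edges)"
proof -
  interpret weakly_bridged_graph V E
    using assms by (simp add: weakly_bridged_graph_def weakly_bridged_graph_axioms_def)
  let ?free = "\<not> contains_isometric V E propeller_verts propeller_edges \<and>
      \<not> contains_isometric V E (UNIV :: R1_vertex set) R1_edges"
  have "smooth V E" if ?free
    using that distance_point_shadow_convex by (simp add: smooth_def)
  moreover have "point_shadow V E v u = distance_point_shadow V E v u" if ?free "u \<in> V" for u v
    using that gconv_pair by (auto simp: point_shadow_def distance_point_shadow_def)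
  then have "strongly_smooth V E" if ?free
    using that distance_point_shadow_convex by (simp add: strongly_smooth_def)
  moreover have ?free if "smooth V E"
    using that by (intro no_forbidden_subgraph[where C = "interval V E"])
      (auto simp: smooth_def distance_point_shadow_def)
  moreover have ?free if "strongly_smooth V E"
    using that interval_subset_gconv gconv_pair
    by (intro no_forbidden_subgraph[where C = "\<lambda>u x. gconv V E {u, x}"])
      (auto simp: strongly_smooth_def point_shadow_def)
  ultimately show ?thesis by blast
qed

end
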